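(* Let $p\in(0,1)$ and let $\psi_0$ satisfy $\Pi_\Psi(\{\psi_0\})=0$ and $0<\pi_\Psi(\psi_0)<\infty$. Let $\Pi_{\psi_0}$ be a probability measure on $\Psi^{-1}\{\psi_0\}$ and let $\Pi_{\psi_0,p}=p\,\Pi_{\psi_0}+(1-p)\,\Pi$ be the mixture prior on $\Theta$. If $\Pi_{\psi_0}=\Pi(\cdot\,|\,\psi_0)$, the conditional prior of $\theta$ given $\Psi(\theta)=\psi_0$ induced by $\Pi$, then the Bayes factor in favor of $\Psi(\theta)=\psi_0$ based on the mixture prior $\Pi_{\psi_0,p}$ equals the relative belief ratio at $\psi_0$ based on the prior $\Pi$, namely $$BF_{\psi_0,\Psi}(\psi_0\,|\,x)=RB_\Psi(\psi_0\,|\,x).$$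
   Context: Setting: $\{f_\theta:\theta\in\Theta\}$ is a statistical model of densities with respect to a support measure on a sample space $\mathcal X$. The parameter space $\Theta$ is an open subset of a Euclidean space with a prior probability measure $\Pi$ having density $\pi$ with respect to volume. $\Psi$ is a smooth map from $\Theta$ onto a subset of a Euclidean space (the marginal parameter is $\psi=\Psi(\theta)$) whose differential $d\Psi$ has full row rank. $x\in\mathcal X$ is the observed data. The prior predictive density is $m(x)=\int_\Theta f_\theta(x)\,\Pi(d\theta)$, assumed to satisfy $0<m(x)<\infty$, and the posterior density of $\theta$ is $\pi(\theta\,|\,x)=\pi(\theta)f_\theta(x)/m(x)$. $\Pi_\Psi$ is the prior distribution of $\psi=\Psi(\theta)$. Put $J_\Psi(\theta)=\det(d\Psi(\theta)\,d\Psi(\theta)^{t})^{-1/2}$, where $d\Psi(\theta)$ is the Jacobian matrix with rows indexed by the coordinates of $\Psi$. The prior and posterior densities of $\psi$ are $\pi_\Psi(\psi)=\int_{\Psi^{-1}\{\psi\}}\pi(\theta)J_\Psi(\theta)\,d\theta$ and $\pi_\Psi(\psi\,|\,x)=\int_{\Psi^{-1}\{\psi\}}\pi(\theta\,|\,x)J_\Psi(\theta)\,d\theta$, integrals being with respect to volume measure on $\Psi^{-1}\{\psi\}$. The conditional prior $\Pi(\cdot\,|\,\psi)$ is the probability measure on $\Psi^{-1}\{\psi\}$ with density $\pi(\theta)J_\Psi(\theta)/\pi_\Psi(\psi)$ with respect to volume measure on $\Psi^{-1}\{\psi\}$ (in the case where $\Psi^{-1}\{\psi\}$ is discrete, volume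 is counting measure). The relative belief ratio at $\psi$ based on $\Pi$ is $RB_\Psi(\psi\,|\,x)=\pi_\Psi(\psi\,|\,x)/\pi_\Psi(\psi)$. The Bayes factor based on the mixture prior is the ratio of posterior odds to prior odds of $\Psi^{-1}\{\psi_0\}$, $$BF_{\psi_0,\Psi}(\psi_0\,|\,x)=\frac{\Pi_{\psi_0,p}(\Psi^{-1}\{\psi_0\}\,|\,x)}{\Pi_{\psi_0,p}(\Psi^{-1}\{\psi_0\}^c\,|\,x)}\cdot\frac{1-p}{p},$$ where $\Pi_{\psi_0,p}(\cdot\,|\,x)$ is the posterior obtained from the prior $\Pi_{\psi_0,p}$, i.e. $\Pi_{\psi_0,p}(A\,|\,x)=\int_A f_\theta(x)\,\Pi_{\psi_0,p}(d\theta)\big/\int_\Theta f_\theta(x)\,\Pi_{\psi_0,p}(d\theta)$. It is assumed that $\int f_\theta(x)\,\Pi_{\psi_0}(d\theta)<\infty$. *)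

theory Defs
  imports "HOL-Probability.Probability"
begin

section \<open>Hausdorff measure, used as volume measure on the level sets\<close>

text \<open>
  The factor \<open>unit_ball_vol d / 2 ^ d\<close> (the volume of the \<open>d\<close>-dimensional ball of diameter 1)
  makes the \<open>d\<close>-dimensional Hausdorff measure agree with Lebesgue measure on \<open>d\<close>-dimensional
  Euclidean space, with Riemannian volume on \<open>d\<close>-dimensional submanifolds, and with counting
  measure when \<open>d = 0\<close>.  For the last case the empty set needs separate treatment,
  since \<open>0 ^ 0 = 1\<close>.
\<close>

definition hausdorff_gauge :: "nat \<Rightarrow> 'a::metric_space set \<Rightarrow> ennreal" where
  "hausdorff_gauge d S =
     (if S = {} then 0 else ennreal (unit_ball_vol (real d) / 2 ^ d * diameter S ^ d))"

definition hausdorff_pre :: "nat \<Rightarrow> real \<Rightarrow> 'a::metric_space set \<Rightarrow> ennreal" where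
  "hausdorff_pre d \<delta> A =
     (INF C \<in> {C :: nat \<Rightarrow> 'a set. A \<subseteq> (\<Union>i. C i) \<and> (\<forall>i. bounded (C i) \<and> diameter (C i) \<le> \<delta>)}.
        \<Sum>i. hausdorff_gauge d (C i))"

definition hausdorff_outer :: "nat \<Rightarrow> 'a::metric_space set \<Rightarrow> ennreal" where
  "hausdorff_outer d A = (SUP \<delta> \<in> {0<..}. hausdorff_pre d \<delta> A)"

definition hausdorff_measure :: "nat \<Rightarrow> 'a::metric_space measure" where
  "hausdorff_measure d = measure_of UNIV (sets borel) (hausdorff_outer d)"

text \<open>
  Since \<open>measure_of\<close> yields the null measure when its argument is not countably additive,
  we check that the outer measure is countably additive on Borel sets.
\<close>

lemma hausdorff_gauge_empty [simp]: "hausdorff_gauge d {} = 0"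
  by (simp add: hausdorff_gauge_def)

lemma hausdorff_pre_mono: "A \<subseteq> B \<Longrightarrow> hausdorff_pre d \<delta> A \<le> hausdorff_pre d \<delta> B"
  unfolding hausdorff_pre_def by (rule INF_superset_mono) auto

lemma hausdorff_pre_antimono: "\<delta> \<le> \<delta>' \<Longrightarrow> hausdorff_pre d \<delta>' A \<le> hausdorff_pre d \<delta> A"
  unfolding hausdorff_pre_def by (rule INF_superset_mono) (auto intro: order_trans)

lemma hausdorff_pre_empty: "0 < \<delta> \<Longrightarrow> hausdorff_pre d \<delta> {} = 0"
proof -
  assume "0 < \<delta>"
  then have "hausdorff_pre d \<delta> ({}::'a set) \<le> (\<Sum>i::nat. hausdorff_gauge d ({}::'a set))"
    unfolding hausdorff_pre_def by (intro INF_lower2[of "\<lambda>_. {}"]) auto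
  then show ?thesis by simp
qed

lemma hausdorff_pre_UN:
  fixes A :: "nat \<Rightarrow> 'a::metric_space set"
  shows "hausdorff_pre d \<delta> (\<Union>i. A i) \<le> (\<Sum>i. hausdorff_pre d \<delta> (A i))"
proof (rule ennreal_le_epsilon)
  fix e :: real assume fin: "(\<Sum>i. hausdorff_pre d \<delta> (A i)) < top" and e: "0 < e"
  have "\<exists>C. A i \<subseteq> (\<Union>j. C j) \<and> (\<forall>j. bounded (C j) \<and> diameter (C j) \<le> \<delta>) \<and>
      (\<Sum>j::nat. hausdorff_gauge d (C j)) < hausdorff_pre d \<delta> (A i) + ennreal (e * (1/2) ^ Suc i)" for i
  proof -
    have "hausdorff_pre d \<delta> (A i) < top"
      using fin ennreal_suminf_lessD by blast
    then have "hausdorff_pre d \<delta> (A i) < hausdorff_pre d \<delta> (A i) + ennreal (e * (1/2) ^ Suc i)"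
      using e by (simp add: ennreal_add_left_cancel_less less_top)
    then show ?thesis
      by (subst (asm) (1) hausdorff_pre_def) (auto simp: INF_less_iff)
  qed
  then obtain C where C: "\<And>i. A i \<subseteq> (\<Union>j. C i j)"
      "\<And>i j. bounded (C i j)" "\<And>i j. diameter (C i j) \<le> \<delta>"
      "\<And>i. (\<Sum>j::nat. hausdorff_gauge d (C i j)) < hausdorff_pre d \<delta> (A i) + ennreal (e * (1/2) ^ Suc i)"
    by metis
  define D where "D n = (case prod_decode n of (i, j) \<Rightarrow> C i j)" for n
  have "hausdorff_pre d \<delta> (\<Union>i. A i) \<le> (\<Sum>n. hausdorff_gauge d (D n))"
    unfolding hausdorff_pre_def
  proof (intro INF_lower, safe)
    fix x i assume "x \<in> A i"
    then obtain j where "x \<in> C i j" using C(1) by blast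
    then show "x \<in> (\<Union>n. D n)"
      by (auto simp: D_def intro!: exI[of _ "prod_encode (i, j)"])
  qed (auto simp: D_def C split: prod.split)
  also have "\<dots> = (\<Sum>i. \<Sum>j. hausdorff_gauge d (C i j))"
    using suminf_ennreal_2dimen[of "\<lambda>i. \<Sum>j. hausdorff_gauge d (C i j)"
        "\<lambda>(i, j). hausdorff_gauge d (C i j)"]
    by (simp add: o_def D_def case_prod_beta)
  also have "\<dots> \<le> (\<Sum>i. hausdorff_pre d \<delta> (A i) + ennreal (e * (1/2) ^ Suc i))"
    using C(4) by (intro suminf_le) (auto intro: less_imp_le)
  also have "\<dots> = (\<Sum>i. hausdorff_pre d \<delta> (A i)) + (\<Sum>i. ennreal (e * (1/2) ^ Suc i))"
    by (rule suminf_add[symmetric]) auto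
  also have "(\<Sum>i. ennreal (e * (1/2) ^ Suc i)) = ennreal e"
    using sums_mult[OF power_half_series, of e] e
    by (intro suminf_ennreal_eq) auto
  finally show "hausdorff_pre d \<delta> (\<Union>i. A i) \<le> (\<Sum>i. hausdorff_pre d \<delta> (A i)) + ennreal e" .
qed

lemma hausdorff_outer_mono: "A \<subseteq> B \<Longrightarrow> hausdorff_outer d A \<le> hausdorff_outer d B"
  unfolding hausdorff_outer_def by (intro SUP_mono) (auto intro: hausdorff_pre_mono)

lemma hausdorff_outer_empty [simp]: "hausdorff_outer d {} = 0"
  unfolding hausdorff_outer_def by (auto simp: hausdorff_pre_empty intro: antisym SUP_least)

lemma hausdorff_outer_UN:
  fixes A :: "nat \<Rightarrow> 'a::metric_space set"
  shows "hausdorff_outer d (\<Union>i. A i) \<le> (\<Sum>i. hausdorff_outer d (A i))"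
  unfolding hausdorff_outer_def
proof (rule SUP_least)
  fix \<delta> :: real assume \<delta>: "\<delta> \<in> {0<..}"
  show "hausdorff_pre d \<delta> (\<Union>i. A i) \<le> (\<Sum>i. SUP \<delta> \<in> {0<..}. hausdorff_pre d \<delta> (A i))"
    by (rule order_trans[OF hausdorff_pre_UN]) (use \<delta> in \<open>auto intro!: suminf_le SUP_upper\<close>)
qed

lemma outer_measure_space_hausdorff:
  "outer_measure_space UNIV (hausdorff_outer d :: 'a::metric_space set \<Rightarrow> ennreal)"
  unfolding outer_measure_space_def positive_def increasing_def countably_subadditive_def
  by (auto intro: hausdorff_outer_mono hausdorff_outer_UN)

lemma hausdorff_outer_Un: "hausdorff_outer d (A \<union> B) \<le> hausdorff_outer d A + hausdorff_outer d B"
proof -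
  define F where "F i = (if i = 0 then A else if i = 1 then B else {})" for i :: nat
  have "(\<Union>i. F i) = A \<union> B" by (auto simp: F_def split: if_splits)
  moreover have "(\<Sum>i. hausdorff_outer d (F i)) = (\<Sum>i\<in>{0,1}. hausdorff_outer d (F i))"
    by (rule suminf_finite) (auto simp: F_def)
  ultimately show ?thesis
    using hausdorff_outer_UN[of d F] by (simp add: F_def)
qed

lemma hausdorff_pre_separated:
  assumes "\<And>x y. x \<in> A \<Longrightarrow> y \<in> B \<Longrightarrow> \<delta> < dist x y"
  shows "hausdorff_pre d \<delta> A + hausdorff_pre d \<delta> B \<le> hausdorff_pre d \<delta> (A \<union> B)"
  unfolding hausdorff_pre_def[of d \<delta> "A \<union> B"]
proof (rule INF_greatest, clarify)
  fix C :: "nat \<Rightarrow> 'a set"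
  assume C: "A \<union> B \<subseteq> (\<Union>i. C i)" "\<forall>i. bounded (C i) \<and> diameter (C i) \<le> \<delta>"
  define P where "P i = (if C i \<inter> A = {} then {} else C i)" for i
  define Q where "Q i = (if C i \<inter> B = {} then {} else C i)" for i
  have \<delta>: "0 \<le> \<delta>" using C(2) diameter_ge_0 order_trans by blast
  have disj: "C i \<inter> A = {} \<or> C i \<inter> B = {}" for i
  proof (rule ccontr)
    assume "\<not> (C i \<inter> A = {} \<or> C i \<inter> B = {})"
    then obtain x y where xy: "x \<in> C i" "x \<in> A" "y \<in> C i" "y \<in> B" by blast
    then have "dist x y \<le> diameter (C i)" using C(2) diameter_bounded_bound by blast
    then show False using assms[OF xy(2,4)] C(2) by (meson not_less order_trans)
  qed
  have "A \<subseteq> (\<Union>i. P i)" "B \<subseteq> (\<Union>i. Q i)" using C(1) unfolding P_def Q_def by fastforce+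
  moreover have "bounded (P i) \<and> diameter (P i) \<le> \<delta>" "bounded (Q i) \<and> diameter (Q i) \<le> \<delta>" for i
    using C(2) \<delta> by (auto simp: P_def Q_def)
  ultimately have "hausdorff_pre d \<delta> A \<le> (\<Sum>i. hausdorff_gauge d (P i))"
    "hausdorff_pre d \<delta> B \<le> (\<Sum>i. hausdorff_gauge d (Q i))"
    unfolding hausdorff_pre_def by (intro INF_lower; blast)+
  then have "hausdorff_pre d \<delta> A + hausdorff_pre d \<delta> B
      \<le> (\<Sum>i. hausdorff_gauge d (P i)) + (\<Sum>i. hausdorff_gauge d (Q i))" by (rule add_mono)
  also have "\<dots> = (\<Sum>i. hausdorff_gauge d (P i) + hausdorff_gauge d (Q i))"
    by (rule suminf_add) auto
  also have "\<dots> \<le> (\<Sum>i. hausdorff_gauge d (C i))"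
    using disj by (intro suminf_le) (auto simp: P_def Q_def)
  finally show "hausdorff_pre d \<delta> A + hausdorff_pre d \<delta> B \<le> (\<Sum>i. hausdorff_gauge d (C i))" .
qed

lemma hausdorff_outer_separated:
  assumes "0 < e" and sep: "\<And>x y. x \<in> A \<Longrightarrow> y \<in> B \<Longrightarrow> e \<le> dist x y"
  shows "hausdorff_outer d A + hausdorff_outer d B \<le> hausdorff_outer d (A \<union> B)"
proof -
  have "hausdorff_outer d A + hausdorff_outer d B
      = (SUP \<delta>\<in>{0<..}. hausdorff_pre d \<delta> A + hausdorff_pre d \<delta> B)"
    unfolding hausdorff_outer_def
  proof (rule SUP_add_directed_ennreal[symmetric])
    fix i j :: real assume "i \<in> {0<..}" "j \<in> {0<..}"
    then show "\<exists>k\<in>{0<..}. hausdorff_pre d i A + hausdorff_pre d j B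
        \<le> hausdorff_pre d k A + hausdorff_pre d k B"
      by (intro bexI[of _ "min i j"] add_mono hausdorff_pre_antimono) auto
  qed
  also have "\<dots> \<le> hausdorff_outer d (A \<union> B)"
  proof (rule SUP_least)
    fix \<delta> :: real assume "\<delta> \<in> {0<..}"
    define k where "k = min \<delta> (e / 2)"
    have k: "0 < k" "k \<le> \<delta>" "k < e" using \<open>\<delta> \<in> _\<close> \<open>0 < e\<close> by (auto simp: k_def)
    have "hausdorff_pre d \<delta> A + hausdorff_pre d \<delta> B \<le> hausdorff_pre d k A + hausdorff_pre d k B"
      using k by (intro add_mono hausdorff_pre_antimono)
    also have "\<dots> \<le> hausdorff_pre d k (A \<union> B)"
      using sep k by (intro hausdorff_pre_separated) (meson less_le_trans)
    also have "\<dots> \<le> hausdorff_outer d (A \<union> B)"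
      unfolding hausdorff_outer_def using k by (intro SUP_upper) auto
    finally show "hausdorff_pre d \<delta> A + hausdorff_pre d \<delta> B \<le> hausdorff_outer d (A \<union> B)" .
  qed
  finally show ?thesis .
qed

lemma closed_in_hausdorff_lambda_system:
  fixes S :: "'a::metric_space set"
  assumes "closed S"
  shows "S \<in> lambda_system UNIV UNIV (hausdorff_outer d)"
proof (cases "S = {}")
  case False
  let ?H = "hausdorff_outer d :: 'a set \<Rightarrow> ennreal"
  have main: "?H (T \<inter> S) + ?H (T - S) \<le> ?H T" if fin: "?H T < top" for T
  proof -
    define r where "r k = 1 / real (Suc k)" for k
    have r_less: "r k < r j" if "j < k" for j k
      using that by (simp add: r_def field_simps)
    have r_le: "r k \<le> r j" if "j \<le> k" for j k
      using that by (simp add: r_def field_simps)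
    have r_pos: "0 < r k" for k by (simp add: r_def)
    define U where "U k = {x \<in> T. r k \<le> infdist x S}" for k
    define R where "R k = {x \<in> T. r (Suc k) \<le> infdist x S \<and> infdist x S < r k}" for k
    have parity: "(\<Sum>k<N. ?H (R (2 * k + s))) \<le> ?H (\<Union>k<N. R (2 * k + s))" for N s
    proof (induction N)
      case (Suc N)
      have "(\<Sum>k<Suc N. ?H (R (2 * k + s))) \<le> ?H (\<Union>k<N. R (2 * k + s)) + ?H (R (2 * N + s))"
        using Suc by (simp add: add_right_mono)
      also have "\<dots> \<le> ?H ((\<Union>k<N. R (2 * k + s)) \<union> R (2 * N + s))"
      proof (cases N)
        case (Suc M)
        show ?thesis
        proof (rule hausdorff_outer_separated)
          show "0 < r (2 * M + s + 1) - r (2 * N + s)"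
            using r_less[of "2 * M + s + 1" "2 * N + s"] Suc by simp
        next
          fix x y assume x: "x \<in> (\<Union>k<N. R (2 * k + s))" and y: "y \<in> R (2 * N + s)"
          from x obtain k where k: "k < N" "x \<in> R (2 * k + s)" by blast
          have "r (2 * M + s + 1) \<le> r (Suc (2 * k + s))" using k Suc by (intro r_le) auto
          also have "\<dots> \<le> infdist x S" using k by (simp add: R_def)
          also have "\<dots> \<le> infdist y S + dist x y" by (rule infdist_triangle)
          finally show "r (2 * M + s + 1) - r (2 * N + s) \<le> dist x y"
            using y by (simp add: R_def)
        qed
      qed simp
      also have "(\<Union>k<N. R (2 * k + s)) \<union> R (2 * N + s) = (\<Union>k<Suc N. R (2 * k + s))"
        by (auto simp: lessThan_Suc)
      finally show ?case .
    qed simp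
    have parity': "(\<Sum>k<N. ?H (R (2 * k + s))) \<le> ?H T" for N s
      by (rule order_trans[OF parity hausdorff_outer_mono]) (auto simp: R_def)
    have "(\<Sum>k<n. ?H (R k)) \<le> ?H T + ?H T" for n
    proof -
      have "(\<Sum>k<2*n. ?H (R k)) = (\<Sum>k<n. ?H (R (2 * k + 0))) + (\<Sum>k<n. ?H (R (2 * k + 1)))"
        by (induction n) (auto simp: algebra_simps)
      then have "(\<Sum>k<2*n. ?H (R k)) \<le> ?H T + ?H T"
        using add_mono[OF parity'[of 0 n] parity'[of 1 n]] by (simp only:)
      moreover have "(\<Sum>k<n. ?H (R k)) \<le> (\<Sum>k<2*n. ?H (R k))"
        by (rule sum_mono2) auto
      ultimately show ?thesis by (rule order_trans[rotated])
    qed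
    then have "(\<Sum>k. ?H (R k)) \<le> ?H T + ?H T"
      by (subst suminf_eq_SUP) (auto intro: SUP_least)
    then have sumfin: "(\<Sum>k. ?H (R k)) < top"
      using fin by (auto simp: less_top[symmetric] top_unique)
    have step: "?H (T \<inter> S) + ?H (T - S) \<le> ?H T + (\<Sum>k. ?H (R (k + n)))" for n
    proof -
      have "T - S \<subseteq> U n \<union> (\<Union>k. R (k + n))"
      proof
        fix x assume x: "x \<in> T - S"
        then have pos: "0 < infdist x S"
          using assms False by (auto intro: infdist_pos_not_in_closed)
        show "x \<in> U n \<union> (\<Union>k. R (k + n))"
        proof (cases "r n \<le> infdist x S")
          case True then show ?thesis using x by (auto simp: U_def)
        next
          case False
          obtain m where m: "inverse (real (Suc m)) < infdist x S"
            using pos reals_Archimedean by blast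
          define l where "l = (LEAST m. r m \<le> infdist x S)"
          have l: "r l \<le> infdist x S"
            unfolding l_def by (rule LeastI[of _ m]) (use m in \<open>simp add: r_def inverse_eq_divide\<close>)
          have "n < l" using l False r_le[of l n] by (meson not_less order_trans)
          then obtain k where k: "l = Suc (k + n)"
            by (metis add.commute less_imp_Suc_add)
          have "\<not> r (k + n) \<le> infdist x S"
            by (rule not_less_Least) (use k in \<open>simp add: l_def[symmetric]\<close>)
          then show ?thesis using x l k by (auto simp: R_def)
        qed
      qed
      then have "?H (T - S) \<le> ?H (U n) + ?H (\<Union>k. R (k + n))"
        by (rule order_trans[OF hausdorff_outer_mono hausdorff_outer_Un])
      also have "\<dots> \<le> ?H (U n) + (\<Sum>k. ?H (R (k + n)))"
        by (intro add_left_mono hausdorff_outer_UN)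
      finally have "?H (T \<inter> S) + ?H (T - S) \<le> (?H (T \<inter> S) + ?H (U n)) + (\<Sum>k. ?H (R (k + n)))"
        by (simp add: add.assoc add_left_mono)
      also have "?H (T \<inter> S) + ?H (U n) \<le> ?H (T \<inter> S \<union> U n)"
      proof (rule hausdorff_outer_separated[OF r_pos[of n]])
        fix x y assume "x \<in> T \<inter> S" "y \<in> U n"
        then show "r n \<le> dist x y"
          using infdist_le[of x S y] by (auto simp: U_def dist_commute)
      qed
      also have "\<dots> \<le> ?H T" by (rule hausdorff_outer_mono) (auto simp: U_def)
      finally show ?thesis by (simp add: add_right_mono)
    qed
    have "(\<lambda>n. \<Sum>k. ?H (R (k + n))) \<longlonglongrightarrow> 0"
    proof -
      have eq: "?H (R k) = ennreal (enn2real (?H (R k)))" for k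
        using sumfin ennreal_suminf_lessD by (metis ennreal_enn2real)
      have summ: "summable (\<lambda>k. enn2real (?H (R k)))"
        using sumfin eq by (intro summable_suminf_not_top) auto
      have "(\<Sum>k. ?H (R (k + n))) = ennreal (\<Sum>k. enn2real (?H (R (k + n))))" for n
        by (subst eq) (intro suminf_ennreal2 summable_ignore_initial_segment summ, simp)
      moreover have "(\<lambda>n. \<Sum>k. enn2real (?H (R (k + n)))) \<longlonglongrightarrow> 0"
        by (rule suminf_exist_split2[OF summ])
      ultimately show ?thesis using tendsto_ennrealI by fastforce
    qed
    from tendsto_add[OF tendsto_const[of "?H T"] this]
    show ?thesis using step by (intro LIMSEQ_le_const) auto
  qed
  have "?H (T \<inter> S) + ?H (T - S) = ?H T" for T
  proof (rule antisym)
    show "?H (T \<inter> S) + ?H (T - S) \<le> ?H T"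
      using main[of T] by (cases "?H T < top") (auto simp: less_top[symmetric])
    show "?H T \<le> ?H (T \<inter> S) + ?H (T - S)"
      using hausdorff_outer_Un[of d "T \<inter> S" "T - S"] by (simp add: Int_Diff_Un)
  qed
  then show ?thesis
    by (simp add: algebra.lambda_system_eq sigma_algebra.axioms(1)
        sigma_algebra_Pow[of UNIV, simplified])
qed (simp add: lambda_system_def)

lemma sets_hausdorff_measure [simp, measurable_cong]: "sets (hausdorff_measure d) = sets borel"
  unfolding hausdorff_measure_def by (simp add: sets.sets_measure_of_eq[of borel, simplified])

lemma space_hausdorff_measure [simp]: "space (hausdorff_measure d) = UNIV"
  unfolding hausdorff_measure_def by (simp add: space_measure_of_conv)

lemma emeasure_hausdorff_measure:
  fixes A :: "'a::metric_space set"
  assumes A: "A \<in> sets borel"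
  shows "emeasure (hausdorff_measure d) A = hausdorff_outer d A"
proof -
  let ?L = "lambda_system UNIV UNIV (hausdorff_outer d :: 'a set \<Rightarrow> ennreal)"
  have ms: "measure_space UNIV ?L (hausdorff_outer d)"
    using sigma_algebra.caratheodory_lemma[OF sigma_algebra_Pow[of UNIV, simplified]
        outer_measure_space_hausdorff] .
  then have "sigma_algebra UNIV ?L" by (simp add: measure_space_def)
  then have "sigma_sets UNIV (Collect closed) \<subseteq> ?L"
    by (rule sigma_algebra.sigma_sets_subset) (auto intro: closed_in_hausdorff_lambda_system)
  then have sub: "sets borel \<subseteq> ?L"
    by (simp add: borel_eq_closed)
  have "measure_space UNIV (sets borel) (hausdorff_outer d :: 'a set \<Rightarrow> ennreal)"
    by (rule measure_down[OF ms _ sub]) (use sets.sigma_algebra_axioms[of borel] in simp)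
  then show ?thesis
    using A unfolding hausdorff_measure_def
    by (intro emeasure_measure_of_sigma) (auto simp: measure_space_def)
qed


section \<open>Smooth maps\<close>

text \<open>On an open set, \<open>Ck_on k\<close> is the usual class of \<open>k\<close> times continuously differentiable maps.\<close>

fun Ck_on :: "nat \<Rightarrow> ('a::euclidean_space \<Rightarrow> 'b::real_normed_vector) \<Rightarrow> 'a set \<Rightarrow> bool" where
  "Ck_on 0 g S \<longleftrightarrow> continuous_on S g"
| "Ck_on (Suc k) g S \<longleftrightarrow>
     (\<forall>x\<in>S. g differentiable (at x)) \<and>
     (\<forall>b\<in>Basis. Ck_on k (\<lambda>x. frechet_derivative g (at x) b) S)"

definition smooth_on :: "('a::euclidean_space \<Rightarrow> 'b::real_normed_vector) \<Rightarrow> 'a set \<Rightarrow> bool" where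
  "smooth_on g S \<longleftrightarrow> (\<forall>k. Ck_on k g S)"

section \<open>Prior, posterior and marginal densities\<close>

text \<open>
  Integrals of densities over fibers may be infinite, so marginal densities and everything
  derived from them take values in \<open>ennreal\<close>.
\<close>

definition jacobian_matrix :: "(real^'n \<Rightarrow> real^'k) \<Rightarrow> real^'n \<Rightarrow> real^'n^'k" where
  "jacobian_matrix \<Psi> \<theta> = matrix (frechet_derivative \<Psi> (at \<theta>))"

definition jacobian_factor :: "(real^'n \<Rightarrow> real^'k) \<Rightarrow> real^'n \<Rightarrow> real" where
  "jacobian_factor \<Psi> \<theta> =
     det (jacobian_matrix \<Psi> \<theta> ** transpose (jacobian_matrix \<Psi> \<theta>)) powr (- 1 / 2)"

definition fiber :: "(real^'n) set \<Rightarrow> (real^'n \<Rightarrow> real^'k) \<Rightarrow> real^'k \<Rightarrow> (real^'n) set" where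
  "fiber \<Theta> \<Psi> \<psi> = {\<theta> \<in> \<Theta>. \<Psi> \<theta> = \<psi>}"

definition fiber_volume :: "(real^'n) set \<Rightarrow> (real^'n \<Rightarrow> real^'k) \<Rightarrow> real^'k \<Rightarrow> (real^'n) measure" where
  "fiber_volume \<Theta> \<Psi> \<psi> =
     restrict_space (hausdorff_measure (CARD('n) - CARD('k))) (fiber \<Theta> \<Psi> \<psi>)"

definition prior :: "(real^'n) set \<Rightarrow> (real^'n \<Rightarrow> real) \<Rightarrow> (real^'n) measure" where
  "prior \<Theta> \<pi> = density (restrict_space lborel \<Theta>) (\<lambda>\<theta>. ennreal (\<pi> \<theta>))"

definition prior_predictive ::
  "(real^'n) set \<Rightarrow> (real^'n \<Rightarrow> real) \<Rightarrow> (real^'n \<Rightarrow> 'x \<Rightarrow> real) \<Rightarrow> 'x \<Rightarrow> ennreal" where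
  "prior_predictive \<Theta> \<pi> f x = (\<integral>\<^sup>+ \<theta>. ennreal (f \<theta> x) \<partial>prior \<Theta> \<pi>)"

definition posterior_density ::
  "(real^'n) set \<Rightarrow> (real^'n \<Rightarrow> real) \<Rightarrow> (real^'n \<Rightarrow> 'x \<Rightarrow> real) \<Rightarrow> 'x \<Rightarrow> real^'n \<Rightarrow> ennreal" where
  "posterior_density \<Theta> \<pi> f x \<theta> = ennreal (\<pi> \<theta>) * ennreal (f \<theta> x) / prior_predictive \<Theta> \<pi> f x"

definition marginal_density ::
  "(real^'n) set \<Rightarrow> (real^'n \<Rightarrow> real^'k) \<Rightarrow> (real^'n \<Rightarrow> ennreal) \<Rightarrow> real^'k \<Rightarrow> ennreal" where
  "marginal_density \<Theta> \<Psi> g \<psi> =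
     (\<integral>\<^sup>+ \<theta>. g \<theta> * ennreal (jacobian_factor \<Psi> \<theta>) \<partial>fiber_volume \<Theta> \<Psi> \<psi>)"

definition marginal_prior :: "(real^'n) set \<Rightarrow> (real^'n \<Rightarrow> real) \<Rightarrow> (real^'n \<Rightarrow> real^'k) \<Rightarrow> (real^'k) measure" where
  "marginal_prior \<Theta> \<pi> \<Psi> = distr (prior \<Theta> \<pi>) borel \<Psi>"

definition marginal_prior_density ::
  "(real^'n) set \<Rightarrow> (real^'n \<Rightarrow> real) \<Rightarrow> (real^'n \<Rightarrow> real^'k) \<Rightarrow> real^'k \<Rightarrow> ennreal" where
  "marginal_prior_density \<Theta> \<pi> \<Psi> = marginal_density \<Theta> \<Psi> (\<lambda>\<theta>. ennreal (\<pi> \<theta>))"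

definition marginal_posterior_density ::
  "(real^'n) set \<Rightarrow> (real^'n \<Rightarrow> real) \<Rightarrow> (real^'n \<Rightarrow> real^'k) \<Rightarrow> (real^'n \<Rightarrow> 'x \<Rightarrow> real) \<Rightarrow> 'x
    \<Rightarrow> real^'k \<Rightarrow> ennreal" where
  "marginal_posterior_density \<Theta> \<pi> \<Psi> f x = marginal_density \<Theta> \<Psi> (posterior_density \<Theta> \<pi> f x)"

definition conditional_prior ::
  "(real^'n) set \<Rightarrow> (real^'n \<Rightarrow> real) \<Rightarrow> (real^'n \<Rightarrow> real^'k) \<Rightarrow> real^'k \<Rightarrow> (real^'n) measure" where
  "conditional_prior \<Theta> \<pi> \<Psi> \<psi> =
     density (fiber_volume \<Theta> \<Psi> \<psi>)
       (\<lambda>\<theta>. ennreal (\<pi> \<theta>) * ennreal (jacobian_factor \<Psi> \<theta>) / marginal_prior_density \<Theta> \<pi> \<Psi> \<psi>)"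

section \<open>Relative belief ratio and Bayes factor\<close>

definition relative_belief_ratio ::
  "(real^'n) set \<Rightarrow> (real^'n \<Rightarrow> real) \<Rightarrow> (real^'n \<Rightarrow> real^'k) \<Rightarrow> (real^'n \<Rightarrow> 'x \<Rightarrow> real) \<Rightarrow> 'x
    \<Rightarrow> real^'k \<Rightarrow> ennreal" where
  "relative_belief_ratio \<Theta> \<pi> \<Psi> f x \<psi> =
     marginal_posterior_density \<Theta> \<pi> \<Psi> f x \<psi> / marginal_prior_density \<Theta> \<pi> \<Psi> \<psi>"

definition mixture_measure :: "real \<Rightarrow> 'a measure \<Rightarrow> 'a measure \<Rightarrow> 'a measure" where
  "mixture_measure p M N =
     measure_of (space N) (sets N) (\<lambda>A. ennreal p * emeasure M A + ennreal (1 - p) * emeasure N A)"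

lemma sets_mixture_measure [simp, measurable_cong]: "sets (mixture_measure p M N) = sets N"
  by (simp add: mixture_measure_def)

lemma space_mixture_measure [simp]: "space (mixture_measure p M N) = space N"
  by (simp add: mixture_measure_def)

lemma emeasure_mixture_measure:
  assumes "sets M = sets N" and "A \<in> sets N"
  shows "emeasure (mixture_measure p M N) A
    = ennreal p * emeasure M A + ennreal (1 - p) * emeasure N A"
proof (rule emeasure_measure_of[OF mixture_measure_def])
  show "countably_additive (sets (mixture_measure p M N))
     (\<lambda>A. ennreal p * emeasure M A + ennreal (1 - p) * emeasure N A)"
    by (rule countably_additiveI)
       (auto simp: assms suminf_add[symmetric] ennreal_suminf_cmult suminf_emeasure)
qed (use assms sets.space_closed in \<open>auto simp: positive_def\<close>)

text \<open>
  The prior concentrated on the fiber is a measure on the fiber; it is pushed forward to the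
  parameter space along the inclusion before it is mixed with the prior.
\<close>

definition mixture_prior ::
  "real \<Rightarrow> (real^'n) set \<Rightarrow> (real^'n) measure \<Rightarrow> (real^'n \<Rightarrow> real) \<Rightarrow> (real^'n) measure" where
  "mixture_prior p \<Theta> Q \<pi> =
     mixture_measure p (distr Q (restrict_space borel \<Theta>) (\<lambda>\<theta>. \<theta>)) (prior \<Theta> \<pi>)"

definition posterior_prob ::
  "'t measure \<Rightarrow> ('t \<Rightarrow> 'x \<Rightarrow> real) \<Rightarrow> 'x \<Rightarrow> 't set \<Rightarrow> ennreal" where
  "posterior_prob P f x A = (\<integral>\<^sup>+ \<theta>\<in>A. ennreal (f \<theta> x) \<partial>P) / (\<integral>\<^sup>+ \<theta>. ennreal (f \<theta> x) \<partial>P)"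

text \<open>
  If the fiber is null for the prior, then its prior odds under the mixture are
  \<open>p / (1 - p)\<close>, which is where the last factor comes from.
\<close>

definition bayes_factor ::
  "real \<Rightarrow> (real^'n) set \<Rightarrow> (real^'n) measure \<Rightarrow> (real^'n \<Rightarrow> real) \<Rightarrow> (real^'n \<Rightarrow> real^'k)
    \<Rightarrow> (real^'n \<Rightarrow> 'x \<Rightarrow> real) \<Rightarrow> 'x \<Rightarrow> real^'k \<Rightarrow> ennreal" where
  "bayes_factor p \<Theta> Q \<pi> \<Psi> f x \<psi> =
     posterior_prob (mixture_prior p \<Theta> Q \<pi>) f x (fiber \<Theta> \<Psi> \<psi>)
       / posterior_prob (mixture_prior p \<Theta> Q \<pi>) f x (\<Theta> - fiber \<Theta> \<Psi> \<psi>)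
       * ennreal ((1 - p) / p)"

end

theory Submission
  imports Defs
begin

text \<open>
  The fiber over \<open>\<psi>\<^sub>0\<close> is null for the prior and has full measure for \<open>Q\<close>.  Writing
  \<open>N\<close> for the integral of the likelihood against \<open>Q\<close> and \<open>m\<close> for the prior predictive density,
  the posterior odds of the fiber are therefore \<open>p * N / ((1 - p) * m)\<close>, so the Bayes factor is
  \<open>N / m\<close>.  If \<open>Q\<close> is the conditional prior, then \<open>N / m\<close> is the relative belief ratio, since both
  are the integral of \<open>\<pi> * f * J\<close> over the fiber divided by \<open>m\<close> and by the marginal prior density.
\<close>

text \<open>\<open>mixture_measure\<close> is specified only by its values on sets. Linearity of the
  integral in the measure is carried from indicators to all nonnegative measurable functions by the
  standard induction.\<close>

lemma nn_integral_mixture_measure: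
  assumes s: "sets M = sets N" and g: "g \<in> borel_measurable N"
  shows "(\<integral>\<^sup>+ y. g y \<partial>mixture_measure p M N)
    = ennreal p * (\<integral>\<^sup>+ y. g y \<partial>M) + ennreal (1 - p) * (\<integral>\<^sup>+ y. g y \<partial>N)"
  using g
proof (induction rule: borel_measurable_induct)
  case (cong u v)
  have "space M = space N" using s by (rule sets_eq_imp_space_eq)
  then have "(\<integral>\<^sup>+ y. u y \<partial>K) = (\<integral>\<^sup>+ y. v y \<partial>K)" if "K \<in> {M, N, mixture_measure p M N}" for K
    using that cong(3) by (intro nn_integral_cong) auto
  then show ?case using cong(4) by simp
next
  case (set A)
  then show ?case using s by (simp add: emeasure_mixture_measure)
next
  case (mult u c)
  then have "u \<in> borel_measurable M" "u \<in> borel_measurable (mixture_measure p M N)"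
    by (simp_all cong: measurable_cong_sets add: measurable_cong_sets[OF s refl])
  then show ?case using mult by (simp add: nn_integral_cmult algebra_simps)
next
  case (add u v)
  then have "u \<in> borel_measurable M" "u \<in> borel_measurable (mixture_measure p M N)"
    "v \<in> borel_measurable M" "v \<in> borel_measurable (mixture_measure p M N)"
    by (simp_all cong: measurable_cong_sets add: measurable_cong_sets[OF s refl])
  then show ?case using add by (simp add: nn_integral_add algebra_simps)
next
  case (seq U)
  have m: "U i \<in> borel_measurable M" "U i \<in> borel_measurable (mixture_measure p M N)" for i
    using seq(1) by (simp_all cong: measurable_cong_sets add: measurable_cong_sets[OF s refl])
  \<comment> \<open>A supremum of sums splits into a sum of suprema here because both sequences of
    integrals increase; this feeds \<open>ennreal_SUP_add\<close>.\<close>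
  have inc: "incseq (\<lambda>i. \<integral>\<^sup>+ y. U i y \<partial>K)" for K
    using seq(3) by (auto simp: incseq_def le_fun_def intro!: nn_integral_mono)
  have "(\<integral>\<^sup>+ y. (SUP i. U i) y \<partial>K) = (SUP i. \<integral>\<^sup>+ y. U i y \<partial>K)"
    if "K \<in> {M, N, mixture_measure p M N}" for K
    using that m seq(1,3) by (auto simp: image_comp intro!: nn_integral_monotone_convergence_SUP)
  then show ?case
    using inc seq.IH
    by (simp add: SUP_mult_left_ennreal ennreal_SUP_add incseq_def mult_left_mono)
qed

lemma posterior_prob_mixture_measure:
  assumes "sets M = sets N" and "(\<lambda>\<theta>. ennreal (f \<theta> x)) \<in> borel_measurable N" and "A \<in> sets N"
  shows "posterior_prob (mixture_measure p M N) f x A =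
    (ennreal p * (\<integral>\<^sup>+ \<theta>\<in>A. ennreal (f \<theta> x) \<partial>M) + ennreal (1 - p) * (\<integral>\<^sup>+ \<theta>\<in>A. ennreal (f \<theta> x) \<partial>N)) /
    (ennreal p * (\<integral>\<^sup>+ \<theta>. ennreal (f \<theta> x) \<partial>M) + ennreal (1 - p) * (\<integral>\<^sup>+ \<theta>. ennreal (f \<theta> x) \<partial>N))"
  unfolding posterior_prob_def using assms by (simp add: nn_integral_mixture_measure)

lemma smooth_on_imp_continuous_on: "smooth_on g S \<Longrightarrow> continuous_on S g"
  unfolding smooth_on_def using Ck_on.simps(1) by blast

lemma smooth_on_continuous_on_frechet_derivative:
  assumes "smooth_on g S" and "b \<in> Basis"
  shows "continuous_on S (\<lambda>\<theta>. frechet_derivative g (at \<theta>) b)"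
proof -
  \<comment> \<open>One level of the recursion already gives continuity of the derivative in each
    basis direction.\<close>
  have "Ck_on (Suc 0) g S" using assms(1) unfolding smooth_on_def by blast
  then show ?thesis using assms(2) by simp
qed

text \<open>Smoothness makes the matrix entries continuous, the determinant is a polynomial in them,
  and \<open>powr\<close> with a fixed exponent is a Borel function.\<close>

lemma borel_measurable_jacobian_factor:
  fixes \<Psi> :: "real^'n \<Rightarrow> real^'k"
  assumes "smooth_on \<Psi> S"
  shows "jacobian_factor \<Psi> \<in> borel_measurable (restrict_space borel S)"
proof -
  \<comment> \<open>Entry \<open>i\<close>, \<open>j\<close> is component \<open>i\<close> of the
    derivative in the basis direction \<open>axis j 1\<close>.\<close>
  have "continuous_on S (\<lambda>\<theta>. jacobian_matrix \<Psi> \<theta> $ i $ j)" for i j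
    unfolding jacobian_matrix_def matrix_def
    using smooth_on_continuous_on_frechet_derivative[OF assms, of "axis j 1"]
    by (auto intro!: continuous_intros)
  then have "continuous_on S
      (\<lambda>\<theta>. det (jacobian_matrix \<Psi> \<theta> ** transpose (jacobian_matrix \<Psi> \<theta>)))"
    unfolding det_def matrix_matrix_mult_def transpose_def
    by (auto intro!: continuous_on_sum continuous_on_prod continuous_on_mult continuous_on_const)
  from borel_measurable_continuous_on_restrict[OF this] show ?thesis
    unfolding jacobian_factor_def by measurable
qed

text \<open>Continuity makes the fiber closed relative to the open set \<open>\<Theta>\<close>,
  hence the intersection of an open set and a closed set.\<close>

lemma sets_fiber:
  assumes "open \<Theta>" and "continuous_on \<Theta> \<Psi>"
  shows "fiber \<Theta> \<Psi> \<psi> \<in> sets borel"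
proof -
  have "closedin (top_of_set \<Theta>) (fiber \<Theta> \<Psi> \<psi>)"
    unfolding fiber_def using assms(2) by (rule continuous_closedin_preimage_constant)
  then obtain C where "closed C" "fiber \<Theta> \<Psi> \<psi> = \<Theta> \<inter> C"
    by (auto simp: closedin_closed)
  then show ?thesis using assms(1) by simp
qed

theorem proposition5:
  fixes \<Theta> :: "(real^'n) set"
    and \<pi> :: "real^'n \<Rightarrow> real"
    and \<Psi> :: "real^'n \<Rightarrow> real^'k"
    and \<mu> :: "'x measure"
    and f :: "real^'n \<Rightarrow> 'x \<Rightarrow> real"
    and x :: 'x
    and p :: real
    and \<psi>\<^sub>0 :: "real^'k"
    and Q :: "(real^'n) measure"
  assumes "open \<Theta>"
    and "\<pi> \<in> borel_measurable (restrict_space borel \<Theta>)"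
    and "\<And>\<theta>. \<theta> \<in> \<Theta> \<Longrightarrow> 0 \<le> \<pi> \<theta>"
    and "prob_space (prior \<Theta> \<pi>)"
    and "smooth_on \<Psi> \<Theta>"
    and "\<And>\<theta>. \<theta> \<in> \<Theta> \<Longrightarrow> rank (jacobian_matrix \<Psi> \<theta>) = CARD('k)"
    and "\<And>\<theta>. \<theta> \<in> \<Theta> \<Longrightarrow> f \<theta> \<in> borel_measurable \<mu>"
    and "\<And>\<theta> y. \<theta> \<in> \<Theta> \<Longrightarrow> y \<in> space \<mu> \<Longrightarrow> 0 \<le> f \<theta> y"
    and "\<And>\<theta>. \<theta> \<in> \<Theta> \<Longrightarrow> (\<integral>\<^sup>+ y. ennreal (f \<theta> y) \<partial>\<mu>) = 1"
    and "x \<in> space \<mu>"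
    and "(\<lambda>\<theta>. f \<theta> x) \<in> borel_measurable (restrict_space borel \<Theta>)"
    and "0 < prior_predictive \<Theta> \<pi> f x" and "prior_predictive \<Theta> \<pi> f x < \<infinity>"
    and "0 < p" and "p < 1"
    and "emeasure (marginal_prior \<Theta> \<pi> \<Psi>) {\<psi>\<^sub>0} = 0"
    and "0 < marginal_prior_density \<Theta> \<pi> \<Psi> \<psi>\<^sub>0" and "marginal_prior_density \<Theta> \<pi> \<Psi> \<psi>\<^sub>0 < \<infinity>"
    and "prob_space Q"
    and "sets Q = sets (restrict_space borel (fiber \<Theta> \<Psi> \<psi>\<^sub>0))"
    and "(\<integral>\<^sup>+ \<theta>. ennreal (f \<theta> x) \<partial>Q) < \<infinity>"
    and "Q = conditional_prior \<Theta> \<pi> \<Psi> \<psi>\<^sub>0"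
  shows "bayes_factor p \<Theta> Q \<pi> \<Psi> f x \<psi>\<^sub>0 = relative_belief_ratio \<Theta> \<pi> \<Psi> f x \<psi>\<^sub>0"
proof -
  let ?F = "fiber \<Theta> \<Psi> \<psi>\<^sub>0" and ?d = "marginal_prior_density \<Theta> \<pi> \<Psi> \<psi>\<^sub>0"
  let ?H = "fiber_volume \<Theta> \<Psi> \<psi>\<^sub>0" and ?J = "jacobian_factor \<Psi>"
  let ?f = "\<lambda>\<theta>. ennreal (f \<theta> x)" and ?P = "prior \<Theta> \<pi>"
  let ?D = "distr Q (restrict_space borel \<Theta>) (\<lambda>\<theta>. \<theta>)"
  define m where "m = prior_predictive \<Theta> \<pi> f x"
  define N where "N = (\<integral>\<^sup>+ \<theta>. ?f \<theta> \<partial>Q)"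
  have cont: "continuous_on \<Theta> \<Psi>" using assms(5) by (rule smooth_on_imp_continuous_on)
  have F: "?F \<in> sets borel" by (rule sets_fiber[OF assms(1) cont])
  have F_sub: "?F \<subseteq> \<Theta>" by (auto simp: fiber_def)
  have sets_P: "sets ?P = sets (restrict_space borel \<Theta>)"
    by (simp add: prior_def sets_restrict_space)
  have space_P: "space ?P = \<Theta>"
    using sets_eq_imp_space_eq[OF sets_P] by (simp add: space_restrict_space)
  have space_Q: "space Q = ?F"
    using sets_eq_imp_space_eq[OF assms(20)] by (simp add: space_restrict_space)
  have sets_H: "sets ?H = sets (restrict_space borel ?F)"
    by (simp add: fiber_volume_def sets_restrict_space)
  have F_P: "?F \<in> sets ?P" "\<Theta> - ?F \<in> sets ?P"
    using F F_sub assms(1) by (auto simp: sets_P sets_restrict_space_iff)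
  have f_P: "?f \<in> borel_measurable ?P"
    using assms(11) by (simp cong: measurable_cong_sets add: measurable_cong_sets[OF sets_P refl])
  have meas_F: "g \<in> borel_measurable (restrict_space borel ?F)"
    if "g \<in> borel_measurable (restrict_space borel \<Theta>)" for g :: "real^'n \<Rightarrow> real"
    using measurable_restrict_mono[OF that F_sub] .
  have meas_H: "g \<in> borel_measurable ?H"
    if "g \<in> borel_measurable (restrict_space borel \<Theta>)" for g :: "real^'n \<Rightarrow> real"
    using meas_F[OF that] by (simp add: measurable_cong_sets[OF sets_H refl])
  have [measurable]: "\<pi> \<in> borel_measurable ?H" "?J \<in> borel_measurable ?H"
    "(\<lambda>\<theta>. f \<theta> x) \<in> borel_measurable ?H"
    using assms(2,11) borel_measurable_jacobian_factor[OF assms(5)] by (auto intro: meas_H)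

  \<comment> \<open>The inclusion of the fiber into \<open>\<Theta>\<close> is measurable, so
    integrals against the pushforward of \<open>Q\<close> can be computed on the fiber.\<close>
  have "(\<lambda>\<theta>. \<theta>) \<in> measurable (restrict_space borel ?F) (restrict_space borel \<Theta>)"
    using F_sub by (intro measurable_restrict_space3) auto
  then have id_Q: "(\<lambda>\<theta>. \<theta>) \<in> measurable Q (restrict_space borel \<Theta>)"
    by (simp add: measurable_cong_sets[OF assms(20) refl])
  have int_D: "(\<integral>\<^sup>+ \<theta>. g \<theta> \<partial>?D) = (\<integral>\<^sup>+ \<theta>. g \<theta> \<partial>Q)" if "g \<in> borel_measurable ?P" for g
    using that by (intro nn_integral_distr id_Q) (simp add: measurable_cong_sets[OF sets_P refl])

  have Psi_P: "\<Psi> \<in> borel_measurable ?P"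
    using borel_measurable_continuous_on_restrict[OF cont]
    by (simp add: measurable_cong_sets[OF sets_P refl])
  \<comment> \<open>The fiber is the preimage of the point \<open>\<psi>\<^sub>0\<close> under
    \<open>\<Psi>\<close>, and this point has mass zero for the marginal prior.\<close>
  have "emeasure ?P ?F = 0"
    using assms(16) unfolding marginal_prior_def
    by (subst (asm) emeasure_distr[OF Psi_P])
       (auto simp: space_P fiber_def vimage_def Int_def conj_commute)
  then have null: "?F \<in> null_sets ?P" using F_P by (auto simp: null_sets_def)
  have P_F: "(\<integral>\<^sup>+ \<theta>\<in>?F. ?f \<theta> \<partial>?P) = 0"
    by (rule nn_integral_null_set[OF null])
  have "(\<integral>\<^sup>+ \<theta>\<in>(\<Theta> - ?F). ?f \<theta> \<partial>?P) = (\<integral>\<^sup>+ \<theta>. ?f \<theta> \<partial>?P)"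
    by (rule nn_integral_cong_AE) (use AE_not_in[OF null] in \<open>auto simp: space_P split: split_indicator\<close>)
  then have P_Fc: "(\<integral>\<^sup>+ \<theta>\<in>(\<Theta> - ?F). ?f \<theta> \<partial>?P) = m"
    by (simp add: m_def prior_predictive_def)
  \<comment> \<open>\<open>Q\<close> has the fiber as its whole space, so the indicator of the fiber
    is 1 throughout and that of the complement is 0.\<close>
  have D_F: "(\<integral>\<^sup>+ \<theta>\<in>?F. ?f \<theta> \<partial>?D) = N"
    using F_P f_P by (subst int_D) (auto simp: N_def space_Q intro!: nn_integral_cong)
  have D_Fc: "(\<integral>\<^sup>+ \<theta>\<in>(\<Theta> - ?F). ?f \<theta> \<partial>?D) = 0"
  proof -
    have "(\<integral>\<^sup>+ \<theta>\<in>(\<Theta> - ?F). ?f \<theta> \<partial>?D) = (\<integral>\<^sup>+ \<theta>\<in>(\<Theta> - ?F). ?f \<theta> \<partial>Q)"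
      using F_P f_P by (intro int_D) auto
    also have "\<dots> = (\<integral>\<^sup>+ \<theta>. 0 \<partial>Q)" by (rule nn_integral_cong) (simp add: space_Q)
    finally show ?thesis by simp
  qed
  have m: "0 < m" "m < top" and N: "N < top"
    using assms(12,13,21) by (auto simp: m_def N_def)
  \<comment> \<open>\<open>T\<close> is the total integral of the likelihood under the mixture: the
    normalizing constant of both posterior probabilities, which cancels in the odds.\<close>
  define T where "T = ennreal p * N + ennreal (1 - p) * m"
  have post: "posterior_prob (mixture_prior p \<Theta> Q \<pi>) f x ?F = ennreal p * N / T"
    "posterior_prob (mixture_prior p \<Theta> Q \<pi>) f x (\<Theta> - ?F) = ennreal (1 - p) * m / T"
    using F_P f_P int_D[OF f_P] unfolding mixture_prior_def
    by (simp_all add: posterior_prob_mixture_measure sets_P P_F P_Fc D_F D_Fc T_def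
        N_def m_def prior_predictive_def)
  have BF: "bayes_factor p \<Theta> Q \<pi> \<Psi> f x \<psi>\<^sub>0 = N / m"
  proof -
    \<comment> \<open>The cancellation is done in the reals, where field arithmetic applies. This is
      possible because \<open>N\<close> and \<open>m\<close> are finite; \<open>r\<close> may be 0,
      while \<open>s\<close> and the real value of \<open>T\<close> are positive.\<close>
    obtain r where r: "N = ennreal r" "0 \<le> r" using N by (cases N) auto
    obtain s where s: "m = ennreal s" "0 < s" using m by (cases m) auto
    have t: "0 < p * r + (1 - p) * s" using r s assms(14,15) by (intro add_nonneg_pos) auto
    have T: "T = ennreal (p * r + (1 - p) * s)"
      using r s assms(14,15) by (simp add: T_def ennreal_mult ennreal_plus)
    have "ennreal p * N / T = ennreal (p * r / (p * r + (1 - p) * s))"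
      using r t assms(14) by (simp add: T ennreal_mult[symmetric] divide_ennreal)
    moreover have "ennreal (1 - p) * m / T = ennreal ((1 - p) * s / (p * r + (1 - p) * s))"
      using s t assms(15) by (simp add: T ennreal_mult[symmetric] divide_ennreal)
    ultimately have "bayes_factor p \<Theta> Q \<pi> \<Psi> f x \<psi>\<^sub>0 =
        ennreal (p * r / (p * r + (1 - p) * s) / ((1 - p) * s / (p * r + (1 - p) * s)) * ((1 - p) / p))"
      using r s t assms(14,15)
      by (simp add: bayes_factor_def post divide_ennreal ennreal_mult[symmetric])
    also have "p * r / (p * r + (1 - p) * s) / ((1 - p) * s / (p * r + (1 - p) * s)) * ((1 - p) / p) = r / s"
      using s t assms(14,15) by simp
    finally show ?thesis using r s by (simp add: divide_ennreal)
  qed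

  \<comment> \<open>\<open>?I\<close> is the fiber integral shared by both sides. Dividing by
    \<open>?d\<close> gives \<open>N\<close>, and dividing by \<open>m\<close> gives the marginal
    posterior density.\<close>
  let ?I = "\<integral>\<^sup>+ \<theta>. ennreal (\<pi> \<theta>) * ?f \<theta> * ennreal (?J \<theta>) \<partial>?H"
  have "N = (\<integral>\<^sup>+ \<theta>. ennreal (\<pi> \<theta>) * ennreal (?J \<theta>) / ?d * ?f \<theta> \<partial>?H)"
    unfolding N_def assms(22) conditional_prior_def by (rule nn_integral_density) measurable
  \<comment> \<open>Division in \<open>ennreal\<close> is multiplication by \<open>inverse\<close>,
    so the constant can be moved to the right and out of the integral.\<close>
  also have "\<dots> = (\<integral>\<^sup>+ \<theta>. ennreal (\<pi> \<theta>) * ?f \<theta> * ennreal (?J \<theta>) * inverse ?d \<partial>?H)"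
    by (simp add: divide_ennreal_def mult_ac)
  also have "\<dots> = ?I * inverse ?d" by (rule nn_integral_multc) measurable
  finally have N_eq: "N = ?I * inverse ?d" .
  have "marginal_posterior_density \<Theta> \<pi> \<Psi> f x \<psi>\<^sub>0
      = (\<integral>\<^sup>+ \<theta>. ennreal (\<pi> \<theta>) * ?f \<theta> * ennreal (?J \<theta>) * inverse m \<partial>?H)"
    by (simp add: marginal_posterior_density_def marginal_density_def posterior_density_def
        m_def divide_ennreal_def mult_ac)
  also have "\<dots> = ?I * inverse m" by (rule nn_integral_multc) measurable
  \<comment> \<open>Both sides are now \<open>?I * inverse ?d * inverse m\<close> up to the order of
    the factors, so nothing has to be cancelled.\<close>
  finally show ?thesis
    by (simp add: BF N_eq relative_belief_ratio_def divide_ennreal_def mult_ac)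
qed

end
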